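(* For $d\ge 2$ and $\mathbf n=(n_1,\dots,n_d)\in\mathbb N^d$, the critical point $p_h(\mathscr S^d_{\mathbf n})$ is given by $$p_h(\mathscr S^d_{\mathbf n})=\sup\Big\{p:\ p\le \prod_{i=1}^d\ \inf_{k\le n_i}a_k(p)\Big\},$$ where $(a_k(p);\,k\ge1)$ is defined recursively by $$a_1(p)=1-p,\qquad\text{and}\qquad a_k(p)+\frac{p}{a_{k-1}(p)}=1\ \text{ for } k\ge 2.$$ Consequently: (1) The critical point $p_h(\mathscr S^d)$ is the unique solution on $(0,1/4]$ to the equation $$\left(\frac{1+\sqrt{1-4p}}{2}\right)^d=p .$$ (2) Suppose that there exists a $1$-dependent $q$-coloring $X$ of the $d$-ray star graph $\mathscr S^d$ with $(X_v)_{v\in V}$ identically distributed. Then $$q\ge \frac{1}{p_h(\mathscr S^d)},$$ where $p_h(\mathscr S^d)$ is given by the equation in (1). So there is no $1$-dependent $4$-coloring of the $3$-ray star graph $\mathscr S^3$ which is invariant in law under permutations of the colors.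
   Context: $\mathbb N=\{1,2,\dots\}$ and $[q]=\{1,\dots,q\}$. The $d$-ray star graph $\mathscr S^d$ consists of a distinguished vertex $v_0$ and $d$ infinite rays $(v_{i1},v_{i2},\dots)$, $1\le i\le d$, emanating from $v_0$: the edges are $v_0v_{i1}$ and $v_{ij}v_{i,j+1}$ for $1\le i\le d$, $j\ge 1$. For $\mathbf n=(n_1,\dots,n_d)\in\mathbb N^d$, $\mathscr S^d_{\mathbf n}$ is the finite subgraph of $\mathscr S^d$ with $d$ rays of lengths $n_1,\dots,n_d$ respectively, i.e. the subgraph induced on $v_0$ and the vertices $v_{ij}$ with $1\le i\le d$, $1\le j\le n_i$. Let $G=(V,E)$ be a simple graph. A process $X=(X_v)_{v\in V}$ is a (proper) $q$-coloring of $G$ if each $X_v$ takes values in $[q]$ and almost surely $X_u\ne X_v$ whenever $u$ and $v$ are neighbors. A process indexed by $V$ is $1$-dependent if its restrictions to two subsets of $V$ are independent whenever these subsets are at graph distance larger than $1$ from each other. A hard-core process on $G$ is a process $J=(J_v)_{v\in V}\in\{0,1\}^V$ such that almost surely we do not have $J_u=J_v=1$ whenever $u$ and $v$ are neighbors. The critical point of $G$ is $$p_h(G)=\sup\{p:\ \text{there exists a 1-dependent hard-core process } J \text{ on } G \text{ with } \mathbb P(J_v=1)=p\ \ \forall v\in V\}.$$ A $q$-coloring $X$ is invariant in law under permutations of the colors if $(\sigma(X_v))_{v\in V}$ has the same law as $X$ for every permutation $\sigma$ of $[q]$.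
   Formalization: The supremum is taken only over p in [0,1] with a_k(p) > 0 for all k ≤ n_i, 1 ≤ i ≤ d; without this the formula fails, e.g. for d=2, n=(2,2) the set is unbounded, since p=10 gives a product of infima 81. *)

theory Defs
  imports "HOL-Probability.Probability"
begin

section \<open>Graphs\<close>

text \<open>A graph is a vertex set \<open>V\<close> together with a symmetric, irreflexive
  adjacency relation \<open>E\<close>, so each undirected edge occurs in \<open>E\<close> in both orientations.\<close>

definition simple_graph :: "'v set \<Rightarrow> 'v rel \<Rightarrow> bool" where
  "simple_graph V E \<longleftrightarrow> E \<subseteq> V \<times> V \<and> sym E \<and> irrefl E"

definition induced_edges :: "'v rel \<Rightarrow> 'v set \<Rightarrow> 'v rel" where
  "induced_edges E W = E \<inter> (W \<times> W)"

text \<open>\<open>E ^^ k\<close> relates the end points of walks of length \<open>k\<close>. The infimum of the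
  empty set in \<^typ>\<open>enat\<close> is \<open>\<infinity>\<close>.\<close>

definition graph_dist :: "'v rel \<Rightarrow> 'v \<Rightarrow> 'v \<Rightarrow> enat" where
  "graph_dist E u v = (INF k\<in>{k. (u, v) \<in> E ^^ k}. enat k)"

definition graph_set_dist :: "'v rel \<Rightarrow> 'v set \<Rightarrow> 'v set \<Rightarrow> enat" where
  "graph_set_dist E A B = (INF u\<in>A. INF v\<in>B. graph_dist E u v)"

section \<open>Star graphs\<close>

text \<open>\<open>Center\<close> is \<open>v\<^sub>0\<close> and \<open>Ray i j\<close> is \<open>v\<^sub>i\<^sub>j\<close>, with both indices starting at 1.\<close>

datatype star_vertex = Center | Ray nat nat

definition star_verts :: "nat \<Rightarrow> star_vertex set" where
  "star_verts d = {Center} \<union> {Ray i j | i j. i \<in> {1..d} \<and> 1 \<le> j}"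

definition star_edges :: "nat \<Rightarrow> star_vertex rel" where
  "star_edges d =
     (let F = {(Center, Ray i 1) | i. i \<in> {1..d}} \<union>
              {(Ray i j, Ray i (j + 1)) | i j. i \<in> {1..d} \<and> 1 \<le> j}
      in F \<union> F\<inverse>)"

definition fin_star_verts :: "nat \<Rightarrow> (nat \<Rightarrow> nat) \<Rightarrow> star_vertex set" where
  "fin_star_verts d n = {Center} \<union> {Ray i j | i j. i \<in> {1..d} \<and> j \<in> {1..n i}}"

definition fin_star_edges :: "nat \<Rightarrow> (nat \<Rightarrow> nat) \<Rightarrow> star_vertex rel" where
  "fin_star_edges d n = induced_edges (star_edges d) (fin_star_verts d n)"

lemma simple_graph_star: "simple_graph (star_verts d) (star_edges d)"
  by (auto simp: simple_graph_def star_verts_def star_edges_def Let_def sym_def irrefl_def)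

lemma simple_graph_fin_star: "simple_graph (fin_star_verts d n) (fin_star_edges d n)"
  using simple_graph_star[of d]
  by (auto simp: simple_graph_def fin_star_edges_def induced_edges_def sym_def irrefl_def)

section \<open>Processes on graphs\<close>

definition restricted_process :: "'v set \<Rightarrow> ('v \<Rightarrow> 'w \<Rightarrow> 's) \<Rightarrow> 'w \<Rightarrow> 'v \<Rightarrow> 's" where
  "restricted_process A X = (\<lambda>\<omega>. \<lambda>v\<in>A. X v \<omega>)"

definition one_dependent ::
  "'w measure \<Rightarrow> 's measure \<Rightarrow> 'v set \<Rightarrow> 'v rel \<Rightarrow> ('v \<Rightarrow> 'w \<Rightarrow> 's) \<Rightarrow> bool" where
  "one_dependent M S V E X \<longleftrightarrow>
     (\<forall>A B. A \<subseteq> V \<and> B \<subseteq> V \<and> graph_set_dist E A B > 1 \<longrightarrow>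
        prob_space.indep_var M
          (PiM A (\<lambda>_. S)) (restricted_process A X)
          (PiM B (\<lambda>_. S)) (restricted_process B X))"

definition coloring_process ::
  "nat \<Rightarrow> 'w measure \<Rightarrow> 'v set \<Rightarrow> 'v rel \<Rightarrow> ('v \<Rightarrow> 'w \<Rightarrow> nat) \<Rightarrow> bool" where
  "coloring_process q M V E X \<longleftrightarrow>
     (\<forall>v\<in>V. X v \<in> M \<rightarrow>\<^sub>M count_space {1..q}) \<and>
     (AE \<omega> in M. \<forall>(u, v)\<in>E. X u \<omega> \<noteq> X v \<omega>)"

definition hard_core_process ::
  "'w measure \<Rightarrow> 'v set \<Rightarrow> 'v rel \<Rightarrow> ('v \<Rightarrow> 'w \<Rightarrow> nat) \<Rightarrow> bool" where
  "hard_core_process M V E J \<longleftrightarrow>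
     (\<forall>v\<in>V. J v \<in> M \<rightarrow>\<^sub>M count_space {0, 1}) \<and>
     (AE \<omega> in M. \<forall>(u, v)\<in>E. \<not> (J u \<omega> = 1 \<and> J v \<omega> = 1))"

text \<open>A definition cannot quantify over all types of sample spaces. Probability measures on
  the path space \<^typ>\<open>'v \<Rightarrow> nat\<close> suffice, because a process defined on any other probability
  space can be replaced by the coordinate process under its law.\<close>

definition crit_point :: "'v set \<Rightarrow> 'v rel \<Rightarrow> real" where
  "crit_point V E = Sup {p. \<exists>(M :: ('v \<Rightarrow> nat) measure) J.
      prob_space M \<and> hard_core_process M V E J \<and>
      one_dependent M (count_space {0, 1}) V E J \<and>
      (\<forall>v\<in>V. measure M {\<omega> \<in> space M. J v \<omega> = 1} = p)}"

definition identically_distributed ::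
  "'w measure \<Rightarrow> 's measure \<Rightarrow> 'v set \<Rightarrow> ('v \<Rightarrow> 'w \<Rightarrow> 's) \<Rightarrow> bool" where
  "identically_distributed M S V X \<longleftrightarrow>
     (\<forall>u\<in>V. \<forall>v\<in>V. distr M S (X u) = distr M S (X v))"

definition color_invariant ::
  "nat \<Rightarrow> 'w measure \<Rightarrow> 'v set \<Rightarrow> ('v \<Rightarrow> 'w \<Rightarrow> nat) \<Rightarrow> bool" where
  "color_invariant q M V X \<longleftrightarrow>
     (\<forall>\<sigma>. \<sigma> permutes {1..q} \<longrightarrow>
        distr M (PiM V (\<lambda>_. count_space {1..q})) (restricted_process V (\<lambda>v \<omega>. \<sigma> (X v \<omega>))) =
        distr M (PiM V (\<lambda>_. count_space {1..q})) (restricted_process V X))"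

section \<open>The recursion\<close>

text \<open>The sequence starts at index 1; the value at 0 is a dummy.\<close>

fun a_seq :: "real \<Rightarrow> nat \<Rightarrow> real" where
  "a_seq p 0 = 1"
| "a_seq p (Suc 0) = 1 - p"
| "a_seq p (Suc (Suc k)) = 1 - p / a_seq p (Suc k)"

text \<open>\<open>a_seq p k\<close> stands for a ratio of probabilities: for a 1-dependent hard-core process
  with marginal \<open>p\<close>, it is the conditional probability of seeing no 1 on a path of \<open>k\<close> vertices
  given none on its first \<open>k - 1\<close> vertices. The formula for the critical point therefore
  concerns those \<open>p \<in> [0, 1]\<close> for which the recursion runs through positive values.
  Without positivity a product of two negative factors could exceed \<open>p\<close>: for
  two rays of length 2 and \<open>p = 9/10\<close> one has \<open>a\<^sub>2 = -8\<close> and \<open>p \<le> (-8) * (-8)\<close>,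
  although the critical point is less than 1/2.\<close>

definition star_admissible :: "nat \<Rightarrow> (nat \<Rightarrow> nat) \<Rightarrow> real \<Rightarrow> bool" where
  "star_admissible d n p \<longleftrightarrow>
     0 \<le> p \<and> p \<le> 1 \<and> (\<forall>i\<in>{1..d}. \<forall>k\<in>{1..n i}. 0 < a_seq p k)"

end

theory Submission
  imports Defs
begin

text \<open>
  In a 1-dependent hard-core process with marginal \<open>p\<close>, an occupied vertex forces its neighbours to
  be vacant and is independent of all other vertices. Hence the probability that a finite set is
  vacant satisfies a deletion recursion (\<open>prob_vacant_insert\<close>) and depends on \<open>p\<close> and the
  graph only. For a path it is \<open>path_vacancy\<close>, whose consecutive ratios are the numbers \<open>a_seq p k\<close>.
  For a star with rays of lengths \<open>m i\<close>, the probability of total vacancy is nonnegative precisely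
  when \<open>p\<close> times the vacancy probability of the rays without their first vertices is at most the
  vacancy probability of the full rays (\<open>star_vacancy_bound\<close>). Dividing gives
  \<open>p \<le> \<Prod>i. a_seq p (m i)\<close>. The same inequality, applied to stars cut at the first zero, shows that
  the ratios are positive (\<open>path_vacancy_pos\<close>). So the condition in the formula is necessary.

  It is also sufficient, by an explicit construction. On a forest, put independent
  Bernoulli variables on the vertices and call a vertex occupied if its own variable is 1 and those
  of its children are 0 (\<open>exists_hard_core_on_forest\<close>). Along a ray, marginal \<open>p\<close> means that the
  probabilities of 0 satisfy, from the outer end inwards, the recursion of \<open>a_seq\<close>; at the centre the
  variables of the first ray vertices vanish with probability \<open>\<Prod>i. a_seq p (n i)\<close>, and a thinning
  brings this down to \<open>p\<close>. This settles finite stars (\<open>fin_star_hard_core_iff\<close>).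

  On the infinite star every finite star gives a bound. The sequence \<open>a_seq p\<close> must then
  stay positive forever; it decreases to a root of \<open>x * (1 - x) = p\<close>, so that \<open>p \<le> 1/4\<close> and
  \<open>p \<le> ray_limit p ^ d\<close> (\<open>star_hard_core_bound\<close>). Conversely, the construction with the
  stationary value \<open>ray_limit p\<close> along all rays realises each such \<open>p\<close>. These \<open>p\<close>
  form the interval from 0 to the unique root of \<open>ray_limit p ^ d = p\<close> (\<open>critical_equation\<close>).

  Finally, a color class of a 1-dependent coloring is a 1-dependent hard-core process
  (\<open>hard_core_color_class\<close>), so no color that is equally likely at all vertices can have a
  probability above the critical point.
\<close>

section \<open>Sets at distance larger than one\<close>

text \<open>Distance larger than 1 in terms of single vertices, which is how 1-dependence is used and
  verified below; see \<open>one_less_graph_set_dist_iff\<close>.\<close>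

definition far :: "'v rel \<Rightarrow> 'v set \<Rightarrow> 'v set \<Rightarrow> bool" where
  "far E A B \<longleftrightarrow> (\<forall>u\<in>A. \<forall>v\<in>B. u \<noteq> v \<and> (u, v) \<notin> E)"

lemma one_less_graph_dist_iff: "1 < graph_dist E u v \<longleftrightarrow> u \<noteq> v \<and> (u, v) \<notin> E"
proof
  assume less: "1 < graph_dist E u v"
  have "(u, v) \<notin> E ^^ k" if "k \<le> 1" for k
  proof
    assume "(u, v) \<in> E ^^ k"
    then have "graph_dist E u v \<le> enat k"
      unfolding graph_dist_def by (intro INF_lower) simp
    with less that show False
      by (metis enat_ord_simps(1) leD one_enat_def order_trans)
  qed
  from this[of 0] this[of 1] show "u \<noteq> v \<and> (u, v) \<notin> E"
    by auto
next
  assume nonadj: "u \<noteq> v \<and> (u, v) \<notin> E"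
  have "2 \<le> graph_dist E u v"
    unfolding graph_dist_def
  proof (intro INF_greatest)
    fix k assume k: "k \<in> {k. (u, v) \<in> E ^^ k}"
    have "k \<noteq> 0" "k \<noteq> 1"
      using k nonadj by (auto intro: Nat.gr0I)
    then have "2 \<le> k" by simp
    then show "2 \<le> enat k"
      by (metis enat_ord_simps(1) numeral_eq_enat)
  qed
  then show "1 < graph_dist E u v"
    by (rule less_le_trans[rotated]) simp
qed

lemma one_less_graph_set_dist_iff: "1 < graph_set_dist E A B \<longleftrightarrow> far E A B"
proof -
  \<comment> \<open>Unlike the strict inequality, a lower bound \<open>2 \<le> _\<close> passes through infima.\<close>
  have less_iff: "1 < x \<longleftrightarrow> 2 \<le> x" for x :: enat
    using ileI1[of 1 x] by (auto simp: eSuc_plus_1 one_add_one intro: less_le_trans[of _ 2])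
  have "1 < graph_set_dist E A B \<longleftrightarrow> (\<forall>u\<in>A. \<forall>v\<in>B. 1 < graph_dist E u v)"
    unfolding less_iff graph_set_dist_def by (simp add: le_INF_iff)
  then show ?thesis
    by (simp add: one_less_graph_dist_iff far_def)
qed

section \<open>Vacancy probabilities of a 1-dependent hard-core process\<close>

locale hard_core = prob_space M
  for M :: "'w measure" and V :: "'v set" and E :: "'v rel" and J :: "'v \<Rightarrow> 'w \<Rightarrow> nat" and p :: real +
  assumes hard_core_process: "hard_core_process M V E J"
    and one_dependent: "one_dependent M (count_space {0, 1}) V E J"
    and marginal: "v \<in> V \<Longrightarrow> prob {\<omega> \<in> space M. J v \<omega> = 1} = p"
begin

lemma measurable_J [measurable (raw)]: "v \<in> V \<Longrightarrow> J v \<in> M \<rightarrow>\<^sub>M count_space {0, 1}"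
  using hard_core_process by (auto simp: hard_core_process_def)

lemma J_cases: "v \<in> V \<Longrightarrow> \<omega> \<in> space M \<Longrightarrow> J v \<omega> \<in> {0, 1}"
  using measurable_space[OF measurable_J] by fastforce

definition vacant :: "'v set \<Rightarrow> 'w set" where
  "vacant A = {\<omega> \<in> space M. \<forall>v\<in>A. J v \<omega> = 0}"

lemma J_events [measurable]:
  assumes "v \<in> V"
  shows "{\<omega> \<in> space M. J v \<omega> = 1} \<in> events" "{\<omega> \<in> space M. J v \<omega> = 0} \<in> events"
proof -
  have "J v -` {k} \<inter> space M \<in> events" if "k \<in> {0, 1}" for k
    using that assms by (intro measurable_sets[OF measurable_J]) auto
  from this[of 0] this[of 1]
  show "{\<omega> \<in> space M. J v \<omega> = 1} \<in> events" "{\<omega> \<in> space M. J v \<omega> = 0} \<in> events"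
    by (simp_all add: vimage_def Int_def conj_commute)
qed

lemma vacant_event [measurable]: "finite A \<Longrightarrow> A \<subseteq> V \<Longrightarrow> vacant A \<in> events"
  unfolding vacant_def by (intro sets.sets_Collect_finite_All) (auto intro: J_events)

lemma indep_values:
  assumes "A \<subseteq> V" "B \<subseteq> V" "finite A" "finite B" "far E A B" "x \<in> {0, 1}" "y \<in> {0, 1}"
  shows "prob ({\<omega> \<in> space M. \<forall>v\<in>A. J v \<omega> = x} \<inter> {\<omega> \<in> space M. \<forall>v\<in>B. J v \<omega> = y}) =
    prob {\<omega> \<in> space M. \<forall>v\<in>A. J v \<omega> = x} * prob {\<omega> \<in> space M. \<forall>v\<in>B. J v \<omega> = y}"
proof -
  let ?S = "count_space {0, 1 :: nat}"
  have indep: "indep_var (PiM A (\<lambda>_. ?S)) (restricted_process A J) (PiM B (\<lambda>_. ?S)) (restricted_process B J)"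
    using one_dependent assms by (auto simp: one_dependent_def one_less_graph_set_dist_iff)
  have "PiE A (\<lambda>_. {x}) \<in> sets (PiM A (\<lambda>_. ?S))" "PiE B (\<lambda>_. {y}) \<in> sets (PiM B (\<lambda>_. ?S))"
    using assms by (intro sets_PiM_I_finite; simp)+
  from indep_varD[OF indep this]
  have "prob ((restricted_process A J -` PiE A (\<lambda>_. {x}) \<inter> space M) \<inter>
      (restricted_process B J -` PiE B (\<lambda>_. {y}) \<inter> space M)) =
    prob (restricted_process A J -` PiE A (\<lambda>_. {x}) \<inter> space M) *
    prob (restricted_process B J -` PiE B (\<lambda>_. {y}) \<inter> space M)"
    by (simp only: vimage_Times o_def fst_conv snd_conv Int_ac Int_absorb Int_left_absorb)
  moreover have "(\<lambda>v\<in>A. f v) = (\<lambda>v\<in>A. z) \<longleftrightarrow> (\<forall>v\<in>A. f v = z)" for A and f :: "'v \<Rightarrow> nat" and z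
    by (metis restrict_apply' restrict_ext)
  then have "restricted_process A J -` PiE A (\<lambda>_. {x}) \<inter> space M = {\<omega> \<in> space M. \<forall>v\<in>A. J v \<omega> = x}" for A x
    by (auto simp: restricted_process_def)
  ultimately show ?thesis by simp
qed

lemma prob_vacant_Un:
  assumes "A \<subseteq> V" "B \<subseteq> V" "finite A" "finite B" "far E A B"
  shows "prob (vacant (A \<union> B)) = prob (vacant A) * prob (vacant B)"
proof -
  have "vacant (A \<union> B) = vacant A \<inter> vacant B"
    by (auto simp: vacant_def)
  with indep_values[OF assms, of 0 0] show ?thesis
    by (simp add: vacant_def)
qed

lemma prob_vacant_UN:
  assumes "finite I" "\<And>i. i \<in> I \<Longrightarrow> finite (A i) \<and> A i \<subseteq> V"
    and "\<And>i j. i \<in> I \<Longrightarrow> j \<in> I \<Longrightarrow> i \<noteq> j \<Longrightarrow> far E (A i) (A j)"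
  shows "prob (vacant (\<Union>i\<in>I. A i)) = (\<Prod>i\<in>I. prob (vacant (A i)))"
  using assms
proof (induction I)
  case empty
  then show ?case by (simp add: vacant_def prob_space)
next
  case (insert i I)
  have "far E (A i) (\<Union>j\<in>I. A j)"
    using insert.prems(2)[of i] insert.hyps by (fastforce simp: far_def)
  then have "prob (vacant (A i \<union> (\<Union>j\<in>I. A j))) = prob (vacant (A i)) * prob (vacant (\<Union>j\<in>I. A j))"
    using insert by (intro prob_vacant_Un) auto
  with insert show ?case by simp
qed

text \<open>The deletion recursion. If \<open>v\<close> is occupied, then its neighbours are automatically vacant, so
  on this event only the vertices of \<open>A\<close> away from \<open>v\<close> have to be required vacant; these are
  independent of \<open>J v\<close>. It is the recursion of the independence polynomial at \<open>-p\<close>, so the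
  vacancy probabilities do not depend on the process but only on the graph and on \<open>p\<close>.\<close>

lemma prob_vacant_insert:
  assumes "v \<in> V" "A \<subseteq> V" "finite A" "v \<notin> A"
  shows "prob (vacant (insert v A)) = prob (vacant A) - p * prob (vacant (A - E `` {v}))"
proof -
  let ?occ = "{\<omega> \<in> space M. J v \<omega> = 1}"
  have [measurable]: "?occ \<in> events" "vacant A \<in> events" "vacant (A - E `` {v}) \<in> events"
    using assms by (auto intro!: J_events vacant_event)
  have excl: "AE \<omega> in M. \<forall>(u, v)\<in>E. \<not> (J u \<omega> = 1 \<and> J v \<omega> = 1)"
    using hard_core_process by (auto simp: hard_core_process_def)
  have "prob (?occ \<inter> vacant A) = prob (?occ \<inter> vacant (A - E `` {v}))"
  proof (rule finite_measure_eq_AE)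
    show "AE \<omega> in M. (\<omega> \<in> ?occ \<inter> vacant A) = (\<omega> \<in> ?occ \<inter> vacant (A - E `` {v}))"
      using excl
    proof eventually_elim
      case (elim \<omega>)
      have "J w \<omega> = 0" if "J v \<omega> = 1" "(v, w) \<in> E" "w \<in> A" "\<omega> \<in> space M" for w
        using elim that J_cases[of w \<omega>] assms(2) by auto
      then show ?case by (auto simp: vacant_def)
    qed
  qed (use assms in \<open>auto intro!: sets.Int vacant_event J_events(1)[unfolded One_nat_def]\<close>)
  also have "\<dots> = prob ?occ * prob (vacant (A - E `` {v}))"
    using indep_values[of "{v}" "A - E `` {v}" 1 0] assms by (auto simp: far_def vacant_def)
  finally have occ: "prob (?occ \<inter> vacant A) = p * prob (vacant (A - E `` {v}))"
    using assms by (simp only: marginal)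
  have "vacant (insert v A) = vacant A - (?occ \<inter> vacant A)"
    using J_cases[OF assms(1)] by (auto simp: vacant_def)
  then have "prob (vacant (insert v A)) = prob (vacant A) - prob (?occ \<inter> vacant A)"
    using \<open>vacant A \<in> events\<close> \<open>?occ \<in> events\<close> by (simp only:) (intro finite_measure_Diff, auto)
  with occ show ?thesis by simp
qed

end

section \<open>Hard-core processes on forests\<close>

lemma indep_vars_coordinates:
  assumes "\<And>i. prob_space (N i)"
  shows "prob_space.indep_vars (PiM UNIV N) N (\<lambda>i \<omega>. \<omega> i) UNIV"
proof -
  interpret prob_space "PiM UNIV N" using assms by (rule prob_space_PiM)
  have "distr (PiM UNIV N) (PiM UNIV N) (\<lambda>\<omega>. \<lambda>i\<in>UNIV. \<omega> i) = PiM UNIV (\<lambda>i. distr (PiM UNIV N) (N i) (\<lambda>\<omega>. \<omega> i))"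
    using assms by (simp add: distr_PiM_component distr_id2 restrict_UNIV cong: PiM_cong)
  then show ?thesis
    by (subst indep_vars_iff_distr_eq_PiM) auto
qed

text \<open>Take independent Bernoulli variables \<open>B\<^sub>v\<close> with parameters \<open>b v\<close>, let \<open>C v\<close> be the children
  of \<open>v\<close>, and call \<open>v\<close> occupied if \<open>B\<^sub>v = 1\<close> and \<open>B\<^sub>w = 0\<close> for each child \<open>w\<close>. A vertex and
  its child are never both occupied, because they read the same variable with opposite
  requirements. Whether \<open>v\<close> is occupied depends on \<open>v\<close> and its children only, and for
  distinct non-adjacent vertices these sets are disjoint since no vertex has two parents; this gives
  1-dependence. The set \<open>V\<close> may omit children of its vertices; the variables of such children still
  matter.\<close>

lemma exists_hard_core_on_forest:
  fixes C :: "'v \<Rightarrow> 'v set" and b :: "'v \<Rightarrow> real"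
  assumes b: "\<And>v. 0 \<le> b v \<and> b v \<le> 1"
    and C: "\<And>v. finite (C v)" "\<And>v. v \<notin> C v" "\<And>u v. u \<noteq> v \<Longrightarrow> C u \<inter> C v = {}"
    and E: "\<And>u v. u \<in> V \<Longrightarrow> v \<in> V \<Longrightarrow> (u, v) \<in> E \<longleftrightarrow> v \<in> C u \<or> u \<in> C v" "E \<subseteq> V \<times> V"
    and p: "\<And>v. v \<in> V \<Longrightarrow> b v * (\<Prod>w\<in>C v. 1 - b w) = p"
  shows "\<exists>(M :: ('v \<Rightarrow> nat) measure) J. hard_core M V E J p"
proof -
  define N where "N v = measure_pmf (map_pmf of_bool (bernoulli_pmf (b v)) :: nat pmf)" for v
  define M where "M = PiM UNIV N"
  \<comment> \<open>The pattern \<open>of_bool (w = v)\<close> asks for the value 1 at \<open>v\<close> and 0 at its children.\<close>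
  define J where "J v \<omega> = (of_bool (\<forall>w\<in>insert v (C v). \<omega> w = of_bool (w = v)) :: nat)" for v and \<omega> :: "'v \<Rightarrow> nat"
  have N: "prob_space (N v)" "sets (N v) = UNIV" for v
    by (simp_all add: N_def prob_space_measure_pmf)
  interpret product_prob_space N UNIV
    by (rule product_prob_spaceI) (rule N)
  interpret prob_space M
    unfolding M_def using N by (intro prob_space_PiM)
  have space_N [simp]: "space (N v) = UNIV" for v
    by (simp add: N_def)
  have [measurable_cong]: "sets (N v) = sets (count_space UNIV)" for v
    by (simp add: N_def)
  have J_local: "J v \<in> PiM D N \<rightarrow>\<^sub>M count_space {0, 1}" if "insert v (C v) \<subseteq> D" for v D
  proof -
    have comp: "(\<lambda>\<omega>. \<omega> w) \<in> PiM D N \<rightarrow>\<^sub>M count_space UNIV" if "w \<in> D" for w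
      using measurable_component_singleton[OF that, of N] by (simp add: N_def)
    have "{\<omega> \<in> space (PiM D N). \<forall>w\<in>insert v (C v). \<omega> w = of_bool (w = v)} \<in> sets (PiM D N)"
    proof (intro sets.sets_Collect_finite_All)
      fix w assume "w \<in> insert v (C v)"
      then have [measurable]: "(\<lambda>\<omega>. \<omega> w) \<in> PiM D N \<rightarrow>\<^sub>M count_space UNIV"
        using that by (intro comp) auto
      show "{\<omega> \<in> space (PiM D N). \<omega> w = of_bool (w = v)} \<in> sets (PiM D N)"
        by measurable
    qed (use C in auto)
    then have pred: "Measurable.pred (PiM D N) (\<lambda>\<omega>. \<forall>w\<in>insert v (C v). \<omega> w = of_bool (w = v))"
      by (simp add: pred_def)
    have "(of_bool :: bool \<Rightarrow> nat) \<in> count_space UNIV \<rightarrow>\<^sub>M count_space {0, 1}"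
      by simp
    from measurable_compose[OF pred this] show ?thesis
      unfolding J_def[abs_def] .
  qed
  have coords: "indep_vars N (\<lambda>i \<omega>. \<omega> i) UNIV"
    unfolding M_def by (rule indep_vars_coordinates) (rule N)
  have "hard_core M V E J p"
  proof
    show "hard_core_process M V E J"
      unfolding hard_core_process_def
    proof (intro conjI ballI AE_I2)
      show "J v \<in> M \<rightarrow>\<^sub>M count_space {0, 1}" for v
        unfolding M_def by (intro J_local) auto
      fix \<omega> e assume e: "e \<in> E"
      obtain u v where uv: "e = (u, v)" by force
      with e E have "v \<in> C u \<or> u \<in> C v" by auto
      moreover have "u \<noteq> v" using calculation C(2) by auto
      ultimately show "case e of (u, v) \<Rightarrow> \<not> (J u \<omega> = 1 \<and> J v \<omega> = 1)"
        by (auto simp: uv J_def)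
    qed
    show "one_dependent M (count_space {0, 1}) V E J"
      unfolding one_dependent_def one_less_graph_set_dist_iff
    proof (intro allI impI)
      fix A B assume AB: "A \<subseteq> V \<and> B \<subseteq> V \<and> far E A B"
      define D where "D A = (\<Union>v\<in>A. insert v (C v))" for A
      have disj: "D A \<inter> D B = {}"
      proof -
        have "insert u (C u) \<inter> insert v (C v) = {}" if "u \<in> A" "v \<in> B" for u v
        proof -
          have "u \<noteq> v" "u \<notin> C v" "v \<notin> C u"
            using AB that E(1)[of u v] by (auto simp: far_def)
          with C(3)[of u v] show ?thesis by auto
        qed
        then show ?thesis unfolding D_def by blast
      qed
      have loc: "(\<lambda>\<omega>. \<lambda>v\<in>A. J v \<omega>) \<in> PiM (D A) N \<rightarrow>\<^sub>M PiM A (\<lambda>_. count_space {0, 1})" for A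
        by (intro measurable_restrict J_local) (auto simp: D_def)
      have restr: "restricted_process A J = (\<lambda>\<omega>. \<lambda>v\<in>A. J v \<omega>) \<circ> (\<lambda>\<omega>. restrict (\<lambda>i. \<omega> i) (D A))" for A
      proof -
        have "J v (restrict \<omega> (D A)) = J v \<omega>" if "v \<in> A" for v \<omega>
        proof -
          have "(\<forall>w\<in>insert v (C v). restrict \<omega> (D A) w = of_bool (w = v)) \<longleftrightarrow>
              (\<forall>w\<in>insert v (C v). \<omega> w = of_bool (w = v))"
          proof (rule ball_cong[OF refl])
            fix w assume "w \<in> insert v (C v)"
            then have "w \<in> D A" using that by (auto simp: D_def)
            then show "restrict \<omega> (D A) w = of_bool (w = v) \<longleftrightarrow> \<omega> w = of_bool (w = v)" by simp
          qed
          then show ?thesis unfolding J_def by (rule arg_cong)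
        qed
        then show ?thesis
          unfolding restricted_process_def comp_def by (intro ext) (simp only: restrict_apply cong: if_cong)
      qed
      show "indep_var (PiM A (\<lambda>_. count_space {0, 1})) (restricted_process A J)
          (PiM B (\<lambda>_. count_space {0, 1})) (restricted_process B J)"
        unfolding restr
        by (rule indep_var_compose[OF indep_var_restrict[OF coords disj] loc loc]) auto
    qed
  next
    fix v assume v: "v \<in> V"
    have "{\<omega> \<in> space M. J v \<omega> = 1} = {\<omega> \<in> space M. \<forall>w\<in>insert v (C v). \<omega> w \<in> {of_bool (w = v)}}"
      by (auto simp: J_def)
    then have "emeasure M {\<omega> \<in> space M. J v \<omega> = 1} =
        (\<Prod>w\<in>insert v (C v). emeasure (N w) {of_bool (w = v)})"
      unfolding M_def using C(1) by (simp only:) (rule emeasure_PiM_Collect, auto simp: N)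
    also have "\<dots> = (\<Prod>w\<in>insert v (C v). ennreal (if w = v then b w else 1 - b w))"
    proof (rule prod.cong[OF refl])
      fix w
      have inj: "inj (of_bool :: bool \<Rightarrow> nat)" by (auto simp: inj_def)
      have "emeasure (N w) {of_bool x} = ennreal (pmf (bernoulli_pmf (b w)) x)" for x
        unfolding N_def by (simp add: emeasure_pmf_single pmf_map_inj'[OF inj])
      then show "emeasure (N w) {of_bool (w = v)} = ennreal (if w = v then b w else 1 - b w)"
        using b[of w] by auto
    qed
    also have "\<dots> = ennreal (\<Prod>w\<in>insert v (C v). if w = v then b w else 1 - b w)"
      using b by (intro prod_ennreal) auto
    also have "(\<Prod>w\<in>insert v (C v). if w = v then b w else 1 - b w) = b v * (\<Prod>w\<in>C v. 1 - b w)"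
      using C by (auto intro!: prod.cong)
    finally have "emeasure M {\<omega> \<in> space M. J v \<omega> = 1} = ennreal p"
      using p[OF v] by simp
    moreover have "0 \<le> p"
      using b by (auto simp: p[OF v, symmetric] intro!: mult_nonneg_nonneg prod_nonneg)
    ultimately show "prob {\<omega> \<in> space M. J v \<omega> = 1} = p"
      by (simp add: measure_def)
  qed
  then show ?thesis by blast
qed


section \<open>The upper bound on stars\<close>

text \<open>The vacancy probability of a path with \<open>k\<close> vertices, which is the independence polynomial of the
  path at \<open>-p\<close>. Unlike \<open>a_seq\<close>, it involves no division, so it is the right quantity for every \<open>p\<close>.\<close>

fun path_vacancy :: "real \<Rightarrow> nat \<Rightarrow> real" where
  "path_vacancy p 0 = 1"
| "path_vacancy p (Suc 0) = 1 - p"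
| "path_vacancy p (Suc (Suc k)) = path_vacancy p (Suc k) - p * path_vacancy p k"

lemma path_vacancy_0 [simp]: "path_vacancy 0 k = 1"
  by (induction "0::real" k rule: path_vacancy.induct) auto

text \<open>This identifies \<open>a_seq\<close> as the ratio of consecutive vacancy probabilities. Positivity keeps
  the division in the recursion meaningful.\<close>

lemma path_vacancy_Suc:
  assumes "\<And>j. j \<le> k \<Longrightarrow> 0 < path_vacancy p j"
  shows "path_vacancy p (Suc k) = a_seq p (Suc k) * path_vacancy p k"
  using assms
proof (induction k)
  case (Suc k)
  have pos: "0 < path_vacancy p (Suc k)" "0 < path_vacancy p k"
    using Suc.prems by auto
  have IH: "path_vacancy p (Suc k) = a_seq p (Suc k) * path_vacancy p k"
    using Suc by auto
  with pos have "a_seq p (Suc k) \<noteq> 0" by auto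
  with IH show ?case by (simp add: field_simps)
qed simp

definition ray_segment :: "nat \<Rightarrow> nat \<Rightarrow> nat \<Rightarrow> star_vertex set" where
  "ray_segment i s k = Ray i ` {s..<s + k}"

lemma ray_segment_simps [simp]:
  "finite (ray_segment i s k)"
  "ray_segment i s 0 = {}"
  "ray_segment i s (Suc k) = insert (Ray i (s + k)) (ray_segment i s k)"
  "Center \<notin> ray_segment i s k"
  "Ray j l \<in> ray_segment i s k \<longleftrightarrow> j = i \<and> s \<le> l \<and> l < s + k"
  by (auto simp: ray_segment_def atLeastLessThanSuc)

lemma star_edges_iff [simp]:
  "(Center, Center) \<notin> star_edges d"
  "(Center, Ray i j) \<in> star_edges d \<longleftrightarrow> i \<in> {1..d} \<and> j = 1"
  "(Ray i j, Center) \<in> star_edges d \<longleftrightarrow> i \<in> {1..d} \<and> j = 1"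
  "(Ray i j, Ray i' j') \<in> star_edges d \<longleftrightarrow>
     i = i' \<and> i \<in> {1..d} \<and> (1 \<le> j \<and> j' = Suc j \<or> 1 \<le> j' \<and> j = Suc j')"
  by (auto simp: star_edges_def Let_def)

lemma star_verts_iff [simp]:
  "Center \<in> star_verts d"
  "Ray i j \<in> star_verts d \<longleftrightarrow> i \<in> {1..d} \<and> 1 \<le> j"
  by (auto simp: star_verts_def)

lemma fin_star_verts_iff [simp]:
  "Center \<in> fin_star_verts d n"
  "Ray i j \<in> fin_star_verts d n \<longleftrightarrow> i \<in> {1..d} \<and> j \<in> {1..n i}"
  by (auto simp: fin_star_verts_def)

lemma fin_star_verts_subset: "fin_star_verts d n \<subseteq> star_verts d"
  by (auto simp: fin_star_verts_def star_verts_def)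

lemma induced_star_edges: "induced_edges (star_edges d) (star_verts d) = star_edges d"
  using simple_graph_star[of d] by (auto simp: induced_edges_def simple_graph_def)

text \<open>The vertex set is left open so that the bounds apply to finite stars and to the infinite star
  alike, with finite stars inside \<open>V\<close> as test sets.\<close>

locale star_hard_core = hard_core M V "induced_edges (star_edges d) V" J p
  for M :: "'w measure" and V d J p +
  assumes V_subset: "V \<subseteq> star_verts d" and Center_in: "Center \<in> V"
begin

lemma prob_vacant_segment:
  assumes "i \<in> {1..d}" "1 \<le> s" "ray_segment i s k \<subseteq> V"
  shows "prob (vacant (ray_segment i s k)) = path_vacancy p k"
  using assms(3)
proof (induction k rule: induct_nat_012)
  case 0
  then show ?case by (simp add: vacant_def prob_space)
next
  case 1
  then show ?case
    using prob_vacant_insert[of "Ray i s" "{}"] by (simp add: vacant_def prob_space)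
next
  case (ge2 k)
  let ?v = "Ray i (s + Suc k)"
  have "w \<in> ray_segment i s (Suc k) - induced_edges (star_edges d) V `` {?v} \<longleftrightarrow> w \<in> ray_segment i s k" for w
    using assms ge2.prems by (cases w) (auto simp: induced_edges_def)
  then have "ray_segment i s (Suc k) - induced_edges (star_edges d) V `` {?v} = ray_segment i s k"
    by blast
  then show ?case
    using prob_vacant_insert[of ?v "ray_segment i s (Suc k)"] ge2 by auto
qed

text \<open>The right-hand side is the probability that all rays, cut to lengths \<open>m i\<close>, are vacant.
  The left-hand side is the probability that in addition the centre is occupied: this forces the
  first vertex of each ray to be vacant, which leaves independent rays that are shorter by one.
  For \<open>m i = 0\<close> the truncated subtraction gives the correct factor 1.\<close>

lemma star_vacancy_bound:
  assumes "\<And>i. i \<in> {1..d} \<Longrightarrow> ray_segment i 1 (m i) \<subseteq> V"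
  shows "p * (\<Prod>i=1..d. path_vacancy p (m i - 1)) \<le> (\<Prod>i=1..d. path_vacancy p (m i))"
proof -
  let ?E = "induced_edges (star_edges d) V"
  let ?A = "\<Union>i\<in>{1..d}. ray_segment i 1 (m i)"
  have segments: "prob (vacant (\<Union>i\<in>{1..d}. ray_segment i s (k i))) = (\<Prod>i=1..d. path_vacancy p (k i))"
    if "1 \<le> s" "\<And>i. i \<in> {1..d} \<Longrightarrow> ray_segment i s (k i) \<subseteq> V" for s k
  proof -
    have "far ?E (ray_segment i s (k i)) (ray_segment j s (k j))" if "i \<noteq> j" for i j
      using that by (auto simp: far_def ray_segment_def induced_edges_def)
    then have "prob (vacant (\<Union>i\<in>{1..d}. ray_segment i s (k i))) =
        (\<Prod>i=1..d. prob (vacant (ray_segment i s (k i))))"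
      using that by (intro prob_vacant_UN) auto
    also have "\<dots> = (\<Prod>i=1..d. path_vacancy p (k i))"
      using that by (intro prod.cong) (auto simp: prob_vacant_segment)
    finally show ?thesis .
  qed
  have "w \<in> ?A - ?E `` {Center} \<longleftrightarrow> w \<in> (\<Union>i\<in>{1..d}. ray_segment i 2 (m i - 1))" for w
    using assms Center_in by (cases w) (fastforce simp: induced_edges_def subset_iff)+
  then have "?A - ?E `` {Center} = (\<Union>i\<in>{1..d}. ray_segment i 2 (m i - 1))"
    by blast
  moreover have "?A \<subseteq> V" using assms by blast
  moreover have "ray_segment i 2 (m i - 1) \<subseteq> ray_segment i 1 (m i)" for i
    by (auto simp: ray_segment_def)
  ultimately have "prob (vacant (insert Center ?A)) =
      (\<Prod>i=1..d. path_vacancy p (m i)) - p * (\<Prod>i=1..d. path_vacancy p (m i - 1))"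
    using segments[of 1 m] segments[of 2 "\<lambda>i. m i - 1"] assms Center_in
      prob_vacant_insert[of Center ?A] by fastforce
  with measure_nonneg[of M "vacant (insert Center ?A)"] show ?thesis
    by linarith
qed

lemma marginal_bounds: "0 \<le> p" "p \<le> 1"
  using marginal[OF Center_in] prob_le_1[of "{\<omega> \<in> space M. J Center \<omega> = 1}"]
    measure_nonneg[of M "{\<omega> \<in> space M. J Center \<omega> = 1}"] by auto

text \<open>Let \<open>k\<close> be the first length with vanishing vacancy probability, and cut all rays at length
  \<open>k\<close>. Then \<open>star_vacancy_bound\<close> has a factor 0 on the right, while every factor on
  the left comes from a shorter ray and is positive, so \<open>p = 0\<close>. But then all vacancy probabilities
  are 1.\<close>

lemma path_vacancy_pos:
  assumes rays: "\<And>i. i \<in> {1..d} \<Longrightarrow> ray_segment i 1 (n i) \<subseteq> V"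
    and "i \<in> {1..d}" "k \<le> n i"
  shows "0 < path_vacancy p k"
  using assms(2,3)
proof (induction k arbitrary: i rule: less_induct)
  case (less k)
  show ?case
  proof (cases "k = 0 \<or> p = 0")
    case False
    define m where "m j = min (n j) k" for j
    have m: "ray_segment j 1 (m j) \<subseteq> V" if "j \<in> {1..d}" for j
      using rays[OF that] by (rule subset_trans[rotated]) (auto simp: m_def ray_segment_def)
    have "0 < path_vacancy p (m j - 1)" if "j \<in> {1..d}" for j
      using that False by (intro less.IH[of _ j]) (auto simp: m_def)
    then have "0 < p * (\<Prod>j=1..d. path_vacancy p (m j - 1))"
      using False marginal_bounds by (intro mult_pos_pos prod_pos) auto
    also have "\<dots> \<le> (\<Prod>j=1..d. path_vacancy p (m j))"
      by (rule star_vacancy_bound) (rule m)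
    finally have "path_vacancy p (m i) \<noteq> 0"
      using less.prems by (metis finite_atLeastAtMost less_irrefl prod_zero)
    moreover have "m i = k" using less.prems by (simp add: m_def)
    moreover have "0 \<le> path_vacancy p k"
      using prob_vacant_segment[of i 1 k] m[of i] less.prems(1) \<open>m i = k\<close> measure_nonneg[of M "vacant (ray_segment i 1 k)"]
      by (simp del: ray_segment_simps(3))
    ultimately show ?thesis by simp
  qed auto
qed

text \<open>Cutting each ray at the length \<open>m i\<close> where \<open>a_seq p\<close> is smallest turns
  \<open>star_vacancy_bound\<close>, divided by its positive factors, into the bound with infima.\<close>

theorem marginal_le_prod_Inf:
  assumes rays: "\<And>i. i \<in> {1..d} \<Longrightarrow> ray_segment i 1 (n i) \<subseteq> V"
    and n: "\<And>i. i \<in> {1..d} \<Longrightarrow> 1 \<le> n i"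
  shows "star_admissible d n p" "p \<le> (\<Prod>i=1..d. INF k\<in>{1..n i}. a_seq p k)"
proof -
  have pos: "0 < path_vacancy p k" if "i \<in> {1..d}" "k \<le> n i" for i k
    using rays that by (rule path_vacancy_pos)
  have ratio: "path_vacancy p k = a_seq p k * path_vacancy p (k - 1)" if "i \<in> {1..d}" "k \<in> {1..n i}" for i k
    using path_vacancy_Suc[of "k - 1" p] pos[of i] that by auto
  have a_pos: "0 < a_seq p k" if "i \<in> {1..d}" "k \<in> {1..n i}" for i k
  proof -
    have "k - 1 \<le> n i" using that by (meson atLeastAtMost_iff diff_le_self order_trans)
    with ratio[OF that] pos[of i k] pos[of i "k - 1"] that show ?thesis
      by (simp add: zero_less_mult_iff)
  qed
  then show "star_admissible d n p"
    by (auto simp: star_admissible_def marginal_bounds)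
  have "\<exists>m\<in>{1..n i}. (INF k\<in>{1..n i}. a_seq p k) = a_seq p m" if "i \<in> {1..d}" for i
  proof -
    have "(INF k\<in>{1..n i}. a_seq p k) \<in> a_seq p ` {1..n i}"
      using n[OF that] by (subst cInf_eq_Min) (auto intro!: Min_in)
    then show ?thesis by blast
  qed
  then obtain m where m: "\<And>i. i \<in> {1..d} \<Longrightarrow> m i \<in> {1..n i}"
      "\<And>i. i \<in> {1..d} \<Longrightarrow> (INF k\<in>{1..n i}. a_seq p k) = a_seq p (m i)"
    by metis
  let ?Q = "\<Prod>i=1..d. path_vacancy p (m i - 1)"
  have "p * ?Q \<le> (\<Prod>i=1..d. path_vacancy p (m i))"
  proof (rule star_vacancy_bound)
    fix i assume "i \<in> {1..d}"
    with rays[of i] m(1)[of i] show "ray_segment i 1 (m i) \<subseteq> V"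
      by (auto simp: ray_segment_def)
  qed
  also have "\<dots> = (\<Prod>i=1..d. a_seq p (m i)) * ?Q"
    unfolding prod.distrib[symmetric] using m(1) by (intro prod.cong refl ratio)
  also have "(\<Prod>i=1..d. a_seq p (m i)) = (\<Prod>i=1..d. INF k\<in>{1..n i}. a_seq p k)"
    using m(2) by simp
  finally show "p \<le> (\<Prod>i=1..d. INF k\<in>{1..n i}. a_seq p k)"
  proof (rule mult_right_le_imp_le)
    show "0 < ?Q"
    proof (intro prod_pos ballI)
      fix i assume i: "i \<in> {1..d}"
      then show "0 < path_vacancy p (m i - 1)"
        using m(1)[OF i] by (intro pos[of i]) auto
    qed
  qed
qed

end

section \<open>Construction of processes on stars\<close>

text \<open>The stars are rooted at the centre. The labels \<open>Ray i 0\<close> name no vertex and get no child, so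
  that \<open>Ray i 1\<close> has the centre as its only parent.\<close>

fun star_children :: "nat \<Rightarrow> star_vertex \<Rightarrow> star_vertex set" where
  "star_children d Center = {Ray i 1 | i. i \<in> {1..d}}"
| "star_children d (Ray i j) = (if j = 0 then {} else {Ray i (Suc j)})"

text \<open>Here \<open>\<alpha> i j\<close> is the probability that the Bernoulli variable at \<open>Ray i j\<close> vanishes. At the
  centre all first variables vanish with probability \<open>\<Prod>i. \<alpha> i 1 \<ge> p\<close>, and the variable of the
  centre itself thins this down to exactly \<open>p\<close>.\<close>

lemma exists_star_hard_core:
  fixes \<alpha> :: "nat \<Rightarrow> nat \<Rightarrow> real"
  assumes \<alpha>: "\<And>i j. 0 \<le> \<alpha> i j \<and> \<alpha> i j \<le> 1"
    and V: "V \<subseteq> star_verts d"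
    and rays: "\<And>i j. Ray i j \<in> V \<Longrightarrow> (1 - \<alpha> i j) * \<alpha> i (Suc j) = p"
    and p: "0 \<le> p" "p \<le> (\<Prod>i=1..d. \<alpha> i 1)"
  shows "\<exists>(M :: (star_vertex \<Rightarrow> nat) measure) J. hard_core M V (induced_edges (star_edges d) V) J p"
proof (rule exists_hard_core_on_forest)
  let ?P = "\<Prod>i=1..d. \<alpha> i 1"
  define P where "P = ?P"
  \<comment> \<open>If \<open>P = 0\<close>, then also \<open>p = 0\<close>, and the quotient below has the required value 0.\<close>
  define b where "b v = (case v of Center \<Rightarrow> p / P | Ray i j \<Rightarrow> 1 - \<alpha> i j)" for v
  have P: "0 \<le> P" "p \<le> P" using \<alpha> p by (auto simp: P_def intro!: prod_nonneg)
  then show "0 \<le> b v \<and> b v \<le> 1" for v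
    using \<alpha> p by (cases v) (auto simp: b_def divide_le_eq_1)
  have center: "star_children d Center = (\<lambda>i. Ray i 1) ` {1..d}"
    by auto
  show "finite (star_children d v)" for v
    by (cases v) (auto simp: center simp del: star_children.simps(1))
  show "v \<notin> star_children d v" for v
    by (cases v) auto
  show "star_children d u \<inter> star_children d v = {}" if "u \<noteq> v" for u v
    using that by (cases u; cases v) auto
  show "(u, v) \<in> induced_edges (star_edges d) V \<longleftrightarrow> v \<in> star_children d u \<or> u \<in> star_children d v"
    if "u \<in> V" "v \<in> V" for u v
    using that V by (cases u; cases v) (auto simp: induced_edges_def)
  show "induced_edges (star_edges d) V \<subseteq> V \<times> V"
    by (auto simp: induced_edges_def)
  show "b v * (\<Prod>w\<in>star_children d v. 1 - b w) = p" if "v \<in> V" for v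
  proof (cases v)
    case Center
    have "(\<Prod>w\<in>star_children d Center. 1 - b w) = P"
      unfolding center by (subst prod.reindex) (auto simp: inj_on_def b_def P_def)
    with p P Center show ?thesis by (auto simp: b_def)
  next
    case (Ray i j)
    then have "Ray i j \<in> star_verts d" using that V by auto
    with rays[of i j] Ray that show ?thesis by (auto simp: b_def)
  qed
qed

section \<open>Finite stars\<close>

lemma a_seq_mult: "a_seq p k \<noteq> 0 \<Longrightarrow> (1 - a_seq p (Suc k)) * a_seq p k = p"
  by (cases k) auto

text \<open>For existence, the requirement \<open>(1 - \<alpha> i j) * \<alpha> i (j + 1) = p\<close> is the recursion of \<open>a_seq\<close>
  read from the outer end of the ray inwards, starting with \<open>\<alpha> = 1\<close> just outside the star.\<close>

theorem fin_star_hard_core_iff: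
  assumes n: "\<And>i. i \<in> {1..d} \<Longrightarrow> 1 \<le> n i"
  shows "(\<exists>(M :: (star_vertex \<Rightarrow> nat) measure) J. hard_core M (fin_star_verts d n) (fin_star_edges d n) J p) \<longleftrightarrow>
    star_admissible d n p \<and> p \<le> (\<Prod>i=1..d. INF k\<in>{1..n i}. a_seq p k)"
proof
  assume "\<exists>(M :: (star_vertex \<Rightarrow> nat) measure) J. hard_core M (fin_star_verts d n) (fin_star_edges d n) J p"
  then obtain M :: "(star_vertex \<Rightarrow> nat) measure" and J
    where "hard_core M (fin_star_verts d n) (fin_star_edges d n) J p" by blast
  then interpret star_hard_core M "fin_star_verts d n" d J p
    by (auto simp: star_hard_core_def star_hard_core_axioms_def fin_star_edges_def fin_star_verts_subset)
  have "ray_segment i 1 (n i) \<subseteq> fin_star_verts d n" if "i \<in> {1..d}" for i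
    using that by (auto simp: ray_segment_def)
  from marginal_le_prod_Inf[OF this n]
  show "star_admissible d n p \<and> p \<le> (\<Prod>i=1..d. INF k\<in>{1..n i}. a_seq p k)"
    by blast
next
  assume adm: "star_admissible d n p \<and> p \<le> (\<Prod>i=1..d. INF k\<in>{1..n i}. a_seq p k)"
  have pos: "0 < a_seq p k" if "i \<in> {1..d}" "k \<le> n i" for i k
    using adm that by (cases "k = 0") (auto simp: star_admissible_def)
  have p: "0 \<le> p" using adm by (simp add: star_admissible_def)
  have le_1: "a_seq p k \<le> 1" if "i \<in> {1..d}" "k \<le> n i" for i k
  proof (cases "k < 2")
    case True
    then have "k = 0 \<or> k = 1" by auto
    with p show ?thesis by auto
  next
    case False
    then obtain l where "k = Suc (Suc l)" by (metis add_2_eq_Suc le_Suc_ex not_less)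
    with p pos[of i "Suc l"] that show ?thesis by simp
  qed
  \<comment> \<open>At \<open>j = n i + 1\<close> the index is 0, and the dummy value \<open>a_seq p 0 = 1\<close> says that the
    variable just outside the star always vanishes.\<close>
  define \<alpha> where "\<alpha> i j = (if i \<in> {1..d} \<and> 1 \<le> j then a_seq p (Suc (n i) - j) else 1)" for i j
  have "\<exists>(M :: (star_vertex \<Rightarrow> nat) measure) J.
      hard_core M (fin_star_verts d n) (induced_edges (star_edges d) (fin_star_verts d n)) J p"
  proof (rule exists_star_hard_core)
    show "0 \<le> \<alpha> i j \<and> \<alpha> i j \<le> 1" for i j
      using pos[of i "Suc (n i) - j"] le_1[of i "Suc (n i) - j"] by (auto simp: \<alpha>_def less_imp_le)
    show "(1 - \<alpha> i j) * \<alpha> i (Suc j) = p" if v: "Ray i j \<in> fin_star_verts d n" for i j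
    proof -
      have "Suc (n i) - j = Suc (n i - j)" using v by (simp add: Suc_diff_le)
      with a_seq_mult[of p "n i - j"] pos[of i "n i - j"] v show ?thesis
        by (simp add: \<alpha>_def)
    qed
    have "(\<Prod>i=1..d. INF k\<in>{1..n i}. a_seq p k) \<le> (\<Prod>i=1..d. \<alpha> i 1)"
    proof (rule prod_mono)
      fix i assume i: "i \<in> {1..d}"
      have "0 \<le> (INF k\<in>{1..n i}. a_seq p k)"
        using n[OF i] pos[OF i] by (intro cINF_greatest) (auto intro: less_imp_le)
      moreover have "(INF k\<in>{1..n i}. a_seq p k) \<le> a_seq p (n i)"
        using n[OF i] by (intro cINF_lower) auto
      ultimately show "0 \<le> (INF k\<in>{1..n i}. a_seq p k) \<and> (INF k\<in>{1..n i}. a_seq p k) \<le> \<alpha> i 1"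
        using i by (simp add: \<alpha>_def)
    qed
    with adm show "p \<le> (\<Prod>i=1..d. \<alpha> i 1)" by linarith
  qed (use p fin_star_verts_subset in auto)
  then show "\<exists>(M :: (star_vertex \<Rightarrow> nat) measure) J. hard_core M (fin_star_verts d n) (fin_star_edges d n) J p"
    by (simp add: fin_star_edges_def)
qed

section \<open>The infinite star\<close>

text \<open>For \<open>p \<le> 1/4\<close>, the larger root of \<open>x * (1 - x) = p\<close>, that is, the larger fixed
  point of the recursion of \<open>a_seq\<close>.\<close>

definition ray_limit :: "real \<Rightarrow> real" where
  "ray_limit p = (1 + sqrt (1 - 4 * p)) / 2"

text \<open>As long as it stays positive, the sequence decreases, so it converges; the limit solves
  \<open>L * (1 - L) = p\<close>. A real solution needs \<open>p \<le> 1/4\<close>, and either root is at most \<open>ray_limit p\<close>.\<close>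

lemma a_seq_limit_bound:
  assumes pos: "\<And>k. 0 < a_seq p k" and "0 \<le> p"
  obtains L where "a_seq p \<longlonglongrightarrow> L" "0 \<le> L" "L \<le> ray_limit p" "p \<le> 1/4"
proof -
  have step: "a_seq p (Suc k) * a_seq p k = a_seq p k - p" for k
    using a_seq_mult[of p k] pos[of k] by (simp add: algebra_simps)
  have ratio: "a_seq p (Suc k) = 1 - p / a_seq p k" for k
    by (cases k) auto
  have "a_seq p (Suc k) \<le> a_seq p k" for k
  proof (induction k)
    case (Suc k)
    then have "p / a_seq p k \<le> p / a_seq p (Suc k)"
      using pos assms(2) by (intro divide_left_mono) auto
    then show ?case unfolding ratio[of "Suc k"] using ratio[of k] by linarith
  qed (use assms in auto)
  then have "decseq (a_seq p)" by (simp add: decseq_Suc_iff)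
  moreover have "0 \<le> a_seq p k" for k using pos less_imp_le by blast
  ultimately obtain L where L: "a_seq p \<longlonglongrightarrow> L" "\<forall>k. L \<le> a_seq p k"
    using decseq_convergent by blast
  have "0 \<le> L"
    using L(1) by (rule LIMSEQ_le_const) (use pos less_imp_le in blast)
  have "(\<lambda>k. a_seq p (Suc k) * a_seq p k) \<longlonglongrightarrow> L * L"
    using L(1) by (intro tendsto_mult) (auto simp: LIMSEQ_Suc)
  moreover have "(\<lambda>k. a_seq p (Suc k) * a_seq p k) \<longlonglongrightarrow> L - p"
    unfolding step using L(1) by (intro tendsto_intros)
  ultimately have "L * L = L - p" by (rule LIMSEQ_unique)
  then have sq: "(2 * L - 1)\<^sup>2 = 1 - 4 * p" by (simp add: power2_eq_square algebra_simps)
  then have "p \<le> 1/4" using zero_le_power2[of "2 * L - 1"] by linarith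
  have "2 * L - 1 \<le> sqrt (1 - 4 * p)"
    using sq by (intro real_le_rsqrt) simp
  then have "L \<le> ray_limit p" by (simp add: ray_limit_def)
  with L \<open>0 \<le> L\<close> \<open>p \<le> 1/4\<close> show ?thesis using that by blast
qed

theorem star_hard_core_bound:
  assumes "hard_core M (star_verts d) (star_edges d) J p" and "1 \<le> d"
  shows "0 \<le> p" "p \<le> 1/4" "p \<le> ray_limit p ^ d"
proof -
  interpret star_hard_core M "star_verts d" d J p
    using assms(1) by (auto simp: star_hard_core_def star_hard_core_axioms_def induced_star_edges)
  show "0 \<le> p" by (rule marginal_bounds)
  have segment: "ray_segment i 1 k \<subseteq> star_verts d" if "i \<in> {1..d}" for i k
    using that by (auto simp: ray_segment_def)
  note bound = marginal_le_prod_Inf[where n = "\<lambda>_. k" for k, OF segment]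
  have pos: "0 < a_seq p k" for k
    using bound(1)[of k] assms(2) by (cases "k = 0") (auto simp: star_admissible_def Ball_def)
  have power: "p \<le> a_seq p k ^ d" if "1 \<le> k" for k
  proof -
    have "p \<le> (\<Prod>i=1..d. INF l\<in>{1..k}. a_seq p l)"
      using that by (intro bound(2)) auto
    also have "\<dots> \<le> (\<Prod>i=1..d. a_seq p k)"
      using that pos by (intro prod_mono conjI cINF_greatest cINF_lower) (auto intro: less_imp_le)
    finally show ?thesis by simp
  qed
  obtain L where L: "a_seq p \<longlonglongrightarrow> L" "0 \<le> L" "L \<le> ray_limit p" "p \<le> 1/4"
    using a_seq_limit_bound[OF pos \<open>0 \<le> p\<close>] by blast
  show "p \<le> 1/4" by fact
  have "(\<lambda>k. a_seq p k ^ d) \<longlonglongrightarrow> L ^ d"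
    using L(1) by (rule tendsto_power)
  then have "p \<le> L ^ d"
    by (rule LIMSEQ_le_const) (use power in blast)
  also have "\<dots> \<le> ray_limit p ^ d"
    using L by (intro power_mono)
  finally show "p \<le> ray_limit p ^ d" .
qed

text \<open>The constant \<open>\<alpha> = ray_limit p\<close> is stationary under the recursion along the rays.\<close>

lemma exists_infinite_star_hard_core:
  assumes "0 \<le> p" "p \<le> 1/4" "p \<le> ray_limit p ^ d"
  shows "\<exists>(M :: (star_vertex \<Rightarrow> nat) measure) J. hard_core M (star_verts d) (star_edges d) J p"
proof -
  have "\<exists>(M :: (star_vertex \<Rightarrow> nat) measure) J.
      hard_core M (star_verts d) (induced_edges (star_edges d) (star_verts d)) J p"
  proof (rule exists_star_hard_core)
    show "0 \<le> ray_limit p \<and> ray_limit p \<le> 1"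
      using assms by (auto simp: ray_limit_def)
    have "sqrt (1 - 4 * p) * sqrt (1 - 4 * p) = 1 - 4 * p"
      using assms by simp
    then show "(1 - ray_limit p) * ray_limit p = p"
      by (simp add: ray_limit_def field_simps)
    show "p \<le> (\<Prod>i=1..d. ray_limit p)" using assms by simp
  qed (use assms in auto)
  then show ?thesis by (simp add: induced_star_edges)
qed

lemma ray_limit_power_le:
  assumes "p \<le> p'" "p' \<le> 1/4"
  shows "ray_limit p' ^ d \<le> ray_limit p ^ d"
  using assms by (intro power_mono) (auto simp: ray_limit_def)

text \<open>The function \<open>ray_limit p ^ d - p\<close> is continuous and strictly decreasing on \<open>[0, 1/4]\<close>, with
  value 1 at 0 and \<open>(1/2) ^ d - 1/4\<close> at \<open>1/4\<close>; the latter is at most 0 because \<open>d \<ge> 2\<close>.\<close>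

lemma critical_equation:
  assumes "2 \<le> d"
  obtains p\<^sub>c where "p\<^sub>c \<in> {0<..1/4}" "ray_limit p\<^sub>c ^ d = p\<^sub>c"
    "\<And>p. 0 \<le> p \<Longrightarrow> p \<le> 1/4 \<Longrightarrow> p \<le> ray_limit p ^ d \<longleftrightarrow> p \<le> p\<^sub>c"
proof -
  have "(1/2) ^ d \<le> (1/2 :: real) ^ 2"
    using assms by (intro power_decreasing) auto
  then have "ray_limit (1/4) ^ d - 1/4 \<le> 0"
    by (simp add: ray_limit_def power2_eq_square)
  moreover have "continuous_on {0..1/4} (\<lambda>p. ray_limit p ^ d - p)"
    unfolding ray_limit_def by (intro continuous_intros) auto
  ultimately obtain p\<^sub>c where pc: "0 \<le> p\<^sub>c" "p\<^sub>c \<le> 1/4" "ray_limit p\<^sub>c ^ d - p\<^sub>c = 0"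
    using IVT2'[of "\<lambda>p. ray_limit p ^ d - p" "1/4" 0 0] by (auto simp: ray_limit_def)
  have "p\<^sub>c \<noteq> 0" using pc(3) by (auto simp: ray_limit_def)
  show ?thesis
  proof
    show "p\<^sub>c \<in> {0<..1/4}" "ray_limit p\<^sub>c ^ d = p\<^sub>c"
      using pc \<open>p\<^sub>c \<noteq> 0\<close> by auto
    show "p \<le> ray_limit p ^ d \<longleftrightarrow> p \<le> p\<^sub>c" if "0 \<le> p" "p \<le> 1/4" for p
      using ray_limit_power_le[of p p\<^sub>c d] ray_limit_power_le[of p\<^sub>c p d] pc that by linarith
  qed
qed

section \<open>Critical points\<close>

lemma crit_point_eq:
  "crit_point V E = Sup {p. \<exists>(M :: ('v \<Rightarrow> nat) measure) J. hard_core M V E J p}"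
  for V :: "'v set"
  by (simp add: crit_point_def hard_core_def hard_core_axioms_def Ball_def conj_assoc)

lemma crit_point_star:
  assumes "2 \<le> d"
  shows "crit_point (star_verts d) (star_edges d) \<in> {0<..1/4}"
    and "ray_limit (crit_point (star_verts d) (star_edges d)) ^ d = crit_point (star_verts d) (star_edges d)"
    and "0 \<le> p \<Longrightarrow> p \<le> 1/4 \<Longrightarrow>
      p \<le> ray_limit p ^ d \<longleftrightarrow> p \<le> crit_point (star_verts d) (star_edges d)"
proof -
  obtain p\<^sub>c where pc: "p\<^sub>c \<in> {0<..1/4}" "ray_limit p\<^sub>c ^ d = p\<^sub>c"
    "\<And>p. 0 \<le> p \<Longrightarrow> p \<le> 1/4 \<Longrightarrow> p \<le> ray_limit p ^ d \<longleftrightarrow> p \<le> p\<^sub>c"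
    using critical_equation[OF assms] by blast
  have "(\<exists>(M :: (star_vertex \<Rightarrow> nat) measure) J. hard_core M (star_verts d) (star_edges d) J p) \<longleftrightarrow>
      p \<in> {0..p\<^sub>c}" for p
    using star_hard_core_bound[of _ d _ p] exists_infinite_star_hard_core[of p d] pc(1) pc(3)[of p] assms
    by fastforce
  then have "crit_point (star_verts d) (star_edges d) = p\<^sub>c"
    unfolding crit_point_eq using pc(1) by (simp only: Collect_mem_eq) simp
  with pc show "crit_point (star_verts d) (star_edges d) \<in> {0<..1/4}"
    and "ray_limit (crit_point (star_verts d) (star_edges d)) ^ d = crit_point (star_verts d) (star_edges d)"
    and "0 \<le> p \<Longrightarrow> p \<le> 1/4 \<Longrightarrow>
      p \<le> ray_limit p ^ d \<longleftrightarrow> p \<le> crit_point (star_verts d) (star_edges d)"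
    by simp_all
qed

section \<open>Colorings\<close>

text \<open>Adjacent vertices never share a color, so each single color class is a hard-core process.\<close>

lemma hard_core_color_class:
  assumes "prob_space M"
    and col: "coloring_process q M V E X"
    and dep: "one_dependent M (count_space {1..q}) V E X"
    and E: "E \<subseteq> V \<times> V"
    and c: "\<And>v. v \<in> V \<Longrightarrow> measure M {\<omega> \<in> space M. X v \<omega> = c} = p"
  shows "hard_core M V E (\<lambda>v \<omega>. of_bool (X v \<omega> = c)) p"
proof -
  interpret prob_space M by fact
  let ?J = "\<lambda>v \<omega>. of_bool (X v \<omega> = c) :: nat"
  have meas: "X v \<in> M \<rightarrow>\<^sub>M count_space {1..q}" if "v \<in> V" for v
    using col that unfolding coloring_process_def by blast
  have class_meas: "(\<lambda>x. of_bool (x = c)) \<in> count_space {1..q} \<rightarrow>\<^sub>M count_space {0, 1 :: nat}"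
    by simp
  show ?thesis
  proof
    have "AE \<omega> in M. \<forall>(u, v)\<in>E. X u \<omega> \<noteq> X v \<omega>"
      using col by (auto simp: coloring_process_def)
    then have "AE \<omega> in M. \<forall>(u, v)\<in>E. \<not> (?J u \<omega> = 1 \<and> ?J v \<omega> = 1)"
      by eventually_elim auto
    then show "hard_core_process M V E ?J"
      using measurable_compose[OF meas class_meas] by (simp add: hard_core_process_def)
    show "one_dependent M (count_space {0, 1}) V E ?J"
      unfolding one_dependent_def
    proof (intro allI impI)
      fix A B assume AB: "A \<subseteq> V \<and> B \<subseteq> V \<and> 1 < graph_set_dist E A B"
      let ?S = "\<lambda>_. count_space {1..q}" and ?T = "\<lambda>_. count_space {0, 1 :: nat}"
      have indep: "indep_var (PiM A ?S) (restricted_process A X) (PiM B ?S) (restricted_process B X)"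
        using dep AB by (auto simp: one_dependent_def)
      have cls: "(\<lambda>x. \<lambda>v\<in>A. of_bool (x v = c)) \<in> PiM A ?S \<rightarrow>\<^sub>M PiM A ?T" for A :: "'b set"
      proof (rule measurable_restrict)
        fix v assume "v \<in> A"
        then have "(\<lambda>x. x v) \<in> PiM A ?S \<rightarrow>\<^sub>M count_space {1..q}"
          by (rule measurable_component_singleton)
        from measurable_compose[OF this class_meas]
        show "(\<lambda>x. of_bool (x v = c)) \<in> PiM A ?S \<rightarrow>\<^sub>M count_space {0, 1 :: nat}" .
      qed
      have "restricted_process A ?J = (\<lambda>x. \<lambda>v\<in>A. of_bool (x v = c)) \<circ> restricted_process A X" for A
        by (auto simp: restricted_process_def fun_eq_iff)
      then show "indep_var (PiM A ?T) (restricted_process A ?J) (PiM B ?T) (restricted_process B ?J)"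
        using indep_var_compose[OF indep cls cls] by simp
    qed
    show "prob {\<omega> \<in> space M. ?J v \<omega> = 1} = p" if "v \<in> V" for v
    proof -
      have "{\<omega> \<in> space M. ?J v \<omega> = 1} = {\<omega> \<in> space M. X v \<omega> = c}" by auto
      then show ?thesis by (simp only: c[OF that])
    qed
  qed
qed

lemma sum_prob_values:
  fixes X :: "'w \<Rightarrow> nat"
  assumes "prob_space M" "X \<in> M \<rightarrow>\<^sub>M count_space {1..q}"
  shows "(\<Sum>c\<in>{1..q}. measure M {\<omega> \<in> space M. X \<omega> = c}) = 1"
proof -
  interpret prob_space M by fact
  have ev: "{\<omega> \<in> space M. X \<omega> = c} \<in> events" if "c \<in> {1..q}" for c
    using measurable_sets[OF assms(2), of "{c}"] that by (simp add: vimage_def Int_def conj_commute)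
  have "(\<Sum>c\<in>{1..q}. prob {\<omega> \<in> space M. X \<omega> = c}) = prob (\<Union>c\<in>{1..q}. {\<omega> \<in> space M. X \<omega> = c})"
    using ev by (intro finite_measure_finite_Union[symmetric]) (auto simp: disjoint_family_on_def)
  also have "(\<Union>c\<in>{1..q}. {\<omega> \<in> space M. X \<omega> = c}) = space M"
    using measurable_space[OF assms(2)] by auto
  finally show ?thesis by (simp add: prob_space)
qed

lemma frequent_color:
  fixes X :: "'w \<Rightarrow> nat"
  assumes "prob_space M" "X \<in> M \<rightarrow>\<^sub>M count_space {1..q}"
  shows "\<exists>c\<in>{1..q}. 1 / q \<le> measure M {\<omega> \<in> space M. X \<omega> = c}"
proof (rule ccontr)
  note total = sum_prob_values[OF assms]
  assume "\<not> (\<exists>c\<in>{1..q}. 1 / q \<le> measure M {\<omega> \<in> space M. X \<omega> = c})"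
  then have less: "measure M {\<omega> \<in> space M. X \<omega> = c} < 1 / q" if "c \<in> {1..q}" for c
    using that by (meson not_le)
  have "q \<noteq> 0" using total by (intro notI) simp
  then have "(\<Sum>c\<in>{1..q}. measure M {\<omega> \<in> space M. X \<omega> = c}) < (\<Sum>c\<in>{1..q}. 1 / q)"
    using less by (intro sum_strict_mono) auto
  with total \<open>q \<noteq> 0\<close> show False by simp
qed

lemma measure_eq_distr_value:
  assumes "X \<in> M \<rightarrow>\<^sub>M count_space S" "c \<in> S"
  shows "measure M {\<omega> \<in> space M. X \<omega> = c} = measure (distr M (count_space S) X) {c}"
  using assms by (subst measure_distr) (auto simp: vimage_def Int_def conj_commute)

text \<open>Some color has probability at least \<open>1/q\<close> at the centre, hence at each vertex, and its color
  class is a hard-core process on the star with this marginal.\<close>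

theorem number_of_colors_ge:
  assumes "2 \<le> d" "prob_space M"
    and col: "coloring_process q M (star_verts d) (star_edges d) X"
    and dep: "one_dependent M (count_space {1..q}) (star_verts d) (star_edges d) X"
    and ident: "identically_distributed M (count_space {1..q}) (star_verts d) X"
  shows "1 / crit_point (star_verts d) (star_edges d) \<le> q"
proof -
  have meas: "X v \<in> M \<rightarrow>\<^sub>M count_space {1..q}" if "v \<in> star_verts d" for v
    using col that unfolding coloring_process_def by blast
  have "X Center \<in> M \<rightarrow>\<^sub>M count_space {1..q}"
    by (rule meas) simp
  from frequent_color[OF \<open>prob_space M\<close> this]
  obtain c where c: "c \<in> {1..q}" "1 / q \<le> measure M {\<omega> \<in> space M. X Center \<omega> = c}" ..
  have same: "measure M {\<omega> \<in> space M. X v \<omega> = c} = measure M {\<omega> \<in> space M. X Center \<omega> = c}"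
    if v: "v \<in> star_verts d" for v
  proof -
    have "distr M (count_space {1..q}) (X v) = distr M (count_space {1..q}) (X Center)"
      using ident v star_verts_iff(1) unfolding identically_distributed_def by blast
    then show ?thesis
      using measure_eq_distr_value[OF meas[OF v] c(1)] measure_eq_distr_value[OF meas[of Center] c(1)]
      by (simp only: star_verts_iff)
  qed
  have "star_edges d \<subseteq> star_verts d \<times> star_verts d"
    using simple_graph_star[of d] unfolding simple_graph_def by blast
  from hard_core_color_class[OF assms(2) col dep this same]
  have process: "hard_core M (star_verts d) (star_edges d) (\<lambda>v \<omega>. of_bool (X v \<omega> = c))
      (measure M {\<omega> \<in> space M. X Center \<omega> = c})" .
  have "1 \<le> d" using assms(1) by simp
  note bound = star_hard_core_bound[OF process this]
  have "1 / q \<le> crit_point (star_verts d) (star_edges d)"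
    using c(2) iffD1[OF crit_point_star(3)[OF assms(1) bound(1,2)] bound(3)] by (rule order_trans)
  moreover have "0 < crit_point (star_verts d) (star_edges d)"
    using crit_point_star(1)[OF assms(1)] by (simp only: greaterThanAtMost_iff)
  moreover have "0 < real q" using c(1) by simp
  ultimately show ?thesis
    by (simp only: divide_le_eq mult.commute if_True)
qed

text \<open>Transposing two colors shows that they are equally likely at \<open>v\<close>.\<close>

lemma color_invariant_prob:
  assumes "prob_space M"
    and meas: "\<And>v. v \<in> V \<Longrightarrow> X v \<in> M \<rightarrow>\<^sub>M count_space {1..q}"
    and inv: "color_invariant q M V X"
    and v: "v \<in> V" and c: "c \<in> {1..q}"
  shows "measure M {\<omega> \<in> space M. X v \<omega> = c} = 1 / q"
proof -
  interpret prob_space M by fact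
  let ?P = "PiM V (\<lambda>_. count_space {1..q})"
  let ?X = "\<lambda>c. {\<omega> \<in> space M. X v \<omega> = c}"
  have same: "prob (?X a) = prob (?X b)" if ab: "a \<in> {1..q}" "b \<in> {1..q}" for a b
  proof -
    define \<sigma> where "\<sigma> = Transposition.transpose a b"
    have \<sigma>: "\<sigma> permutes {1..q}" using ab by (simp add: \<sigma>_def permutes_swap_id)
    have restr: "restricted_process V Y \<in> M \<rightarrow>\<^sub>M ?P"
      if "\<And>v. v \<in> V \<Longrightarrow> Y v \<in> M \<rightarrow>\<^sub>M count_space {1..q}" for Y
      unfolding restricted_process_def using that by (intro measurable_restrict)
    have "(\<lambda>x. \<sigma> x) \<in> count_space {1..q} \<rightarrow>\<^sub>M count_space {1..q}"
      using permutes_in_image[OF \<sigma>] by auto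
    then have perm: "(\<lambda>\<omega>. \<sigma> (X v \<omega>)) \<in> M \<rightarrow>\<^sub>M count_space {1..q}" if "v \<in> V" for v
      by (rule measurable_compose[OF meas[OF that]])
    have "(\<lambda>x. x v) \<in> ?P \<rightarrow>\<^sub>M count_space {1..q}"
      using v by (rule measurable_component_singleton)
    from measurable_sets[OF this, of "{a}"]
    have ev: "(\<lambda>x. x v) -` {a} \<inter> space ?P \<in> sets ?P" using ab by simp
    have value_prob: "measure (distr M ?P (restricted_process V Y)) ((\<lambda>x. x v) -` {a} \<inter> space ?P) =
        prob {\<omega> \<in> space M. Y v \<omega> = a}"
      if Y: "\<And>v. v \<in> V \<Longrightarrow> Y v \<in> M \<rightarrow>\<^sub>M count_space {1..q}" for Y
    proof -
      have "restricted_process V Y -` ((\<lambda>x. x v) -` {a} \<inter> space ?P) \<inter> space M = {\<omega> \<in> space M. Y v \<omega> = a}"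
        using measurable_space[OF restr[OF Y]] v by (auto simp: restricted_process_def)
      then show ?thesis
        by (simp only: measure_distr[OF restr[OF Y] ev])
    qed
    have "prob (?X a) = prob {\<omega> \<in> space M. \<sigma> (X v \<omega>) = a}"
      using value_prob[of X, OF meas] value_prob[of "\<lambda>v \<omega>. \<sigma> (X v \<omega>)", OF perm] inv \<sigma> by (simp add: color_invariant_def)
    also have "{\<omega> \<in> space M. \<sigma> (X v \<omega>) = a} = ?X b"
      unfolding \<sigma>_def by (metis transpose_apply_second transpose_involutory)
    finally show ?thesis .
  qed
  have "(\<Sum>a\<in>{1..q}. prob (?X a)) = (\<Sum>a\<in>{1..q}. prob (?X c))"
    using c by (intro sum.cong refl same)
  with sum_prob_values[OF \<open>prob_space M\<close> meas[OF v]] c show ?thesis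
    by (simp add: field_simps)
qed

text \<open>A color class would have marginal \<open>1/4\<close>, but \<open>ray_limit (1/4) ^ 3 = 1/8\<close>.\<close>

lemma no_color_invariant_4_coloring:
  assumes "prob_space M"
    and col: "coloring_process 4 M (star_verts 3) (star_edges 3) X"
    and dep: "one_dependent M (count_space {1..4}) (star_verts 3) (star_edges 3) X"
    and inv: "color_invariant 4 M (star_verts 3) X"
  shows False
proof -
  have meas: "X v \<in> M \<rightarrow>\<^sub>M count_space {1..4}" if "v \<in> star_verts 3" for v
    using col that unfolding coloring_process_def by blast
  have "measure M {\<omega> \<in> space M. X v \<omega> = 1} = 1 / real 4" if "v \<in> star_verts 3" for v
    by (rule color_invariant_prob[OF assms(1) meas inv that]) auto
  from hard_core_color_class[OF assms(1) col dep _ this]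
  have "hard_core M (star_verts 3) (star_edges 3) (\<lambda>v \<omega>. of_bool (X v \<omega> = 1)) (1 / real 4)"
    using simple_graph_star[of 3] unfolding simple_graph_def by blast
  then have "1 / real 4 \<le> ray_limit (1 / real 4) ^ 3"
    by (rule star_hard_core_bound(3)) simp
  moreover have "ray_limit (1 / real 4) = 1/2"
    by (simp add: ray_limit_def)
  ultimately show False
    by (simp only:) (simp add: power3_eq_cube)
qed

section \<open>The critical points of star graphs and the number of colors\<close>

theorem theorem1p2:
  fixes d :: nat and n :: "nat \<Rightarrow> nat"
  assumes "d \<ge> 2" and "\<forall>i\<in>{1..d}. n i \<ge> 1"
  shows
    "crit_point (fin_star_verts d n) (fin_star_edges d n) =
       Sup {p. star_admissible d n p \<and> p \<le> (\<Prod>i=1..d. INF k\<in>{1..n i}. a_seq p k)} \<and>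
     (\<forall>p::real. (p \<in> {0<..1/4} \<and> ((1 + sqrt (1 - 4 * p)) / 2) ^ d = p) \<longleftrightarrow>
        p = crit_point (star_verts d) (star_edges d)) \<and>
     (\<forall>(q::nat) (M :: 'w measure) X.
        prob_space M \<and>
        coloring_process q M (star_verts d) (star_edges d) X \<and>
        one_dependent M (count_space {1..q}) (star_verts d) (star_edges d) X \<and>
        identically_distributed M (count_space {1..q}) (star_verts d) X \<longrightarrow>
        real q \<ge> 1 / crit_point (star_verts d) (star_edges d)) \<and>
     \<not> (\<exists>(M :: 'w measure) X.
        prob_space M \<and>
        coloring_process 4 M (star_verts 3) (star_edges 3) X \<and>
        one_dependent M (count_space {1..4}) (star_verts 3) (star_edges 3) X \<and>
        color_invariant 4 M (star_verts 3) X)"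
proof (intro conjI allI)
  have n: "1 \<le> n i" if "i \<in> {1..d}" for i
    using assms(2) that by blast
  show "crit_point (fin_star_verts d n) (fin_star_edges d n) =
      Sup {p. star_admissible d n p \<and> p \<le> (\<Prod>i=1..d. INF k\<in>{1..n i}. a_seq p k)}"
    by (simp only: crit_point_eq fin_star_hard_core_iff[OF n])
  fix p :: real
  let ?p\<^sub>c = "crit_point (star_verts d) (star_edges d)"
  show "(p \<in> {0<..1/4} \<and> ((1 + sqrt (1 - 4 * p)) / 2) ^ d = p) \<longleftrightarrow> p = ?p\<^sub>c"
    unfolding ray_limit_def[symmetric]
  proof
    assume p: "p \<in> {0<..1/4} \<and> ray_limit p ^ d = p"
    then have "p \<le> ?p\<^sub>c"
      using crit_point_star(3)[OF assms(1), of p] by simp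
    moreover have "?p\<^sub>c \<le> p"
      using ray_limit_power_le[OF \<open>p \<le> ?p\<^sub>c\<close>, of d] crit_point_star(1,2)[OF assms(1)] p by simp
    ultimately show "p = ?p\<^sub>c" by simp
  next
    assume "p = ?p\<^sub>c"
    then show "p \<in> {0<..1/4} \<and> ray_limit p ^ d = p"
      using crit_point_star(1,2)[OF assms(1)] by metis
  qed
next
  fix q and M :: "'w measure" and X
  show "prob_space M \<and>
        coloring_process q M (star_verts d) (star_edges d) X \<and>
        one_dependent M (count_space {1..q}) (star_verts d) (star_edges d) X \<and>
        identically_distributed M (count_space {1..q}) (star_verts d) X \<longrightarrow>
        real q \<ge> 1 / crit_point (star_verts d) (star_edges d)"
  proof (intro impI, elim conjE)
    assume "prob_space M" "coloring_process q M (star_verts d) (star_edges d) X"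
      "one_dependent M (count_space {1..q}) (star_verts d) (star_edges d) X"
      "identically_distributed M (count_space {1..q}) (star_verts d) X"
    then show "real q \<ge> 1 / crit_point (star_verts d) (star_edges d)"
      by (rule number_of_colors_ge[OF assms(1)])
  qed
next
  show "\<not> (\<exists>(M :: 'w measure) X.
        prob_space M \<and>
        coloring_process 4 M (star_verts 3) (star_edges 3) X \<and>
        one_dependent M (count_space {1..4}) (star_verts 3) (star_edges 3) X \<and>
        color_invariant 4 M (star_verts 3) X)"
  proof (intro notI, elim exE conjE)
    fix M :: "'w measure" and X
    assume "prob_space M" "coloring_process 4 M (star_verts 3) (star_edges 3) X"
      "one_dependent M (count_space {1..4}) (star_verts 3) (star_edges 3) X"
      "color_invariant 4 M (star_verts 3) X"
    then show False by (rule no_color_invariant_4_coloring)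
  qed
qed

end
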